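(* Let $G$ be a group with identity $e$ and let $\mathcal{P}=\{P_0,P_1,\ldots,P_s\}$, $s\ge 1$, be a unitary symmetric partition of $G$, with $P_0=\{e\}$. Suppose that for every $i=1,\ldots,s$ there are an integer $\ell(i)\ge 2$ and distinct indices $j_{i,1},j_{i,2},\ldots,j_{i,\ell(i)}\in\{1,2,\ldots,s\}\smallsetminus\{i\}$ such that $$P_i\ast P_i\subset P_0\cup P_{j_{i,1}}\cup\cdots\cup P_{j_{i,\ell(i)}}$$ and $(P_i\ast P_i)\cap P_{j_{i,k}}\neq\varnothing$ for all $k=1,\ldots,\ell(i)$. Then every metric $d$ on $G$ associated to the partition $\mathcal{P}$ is not interval.
   Context: A partition $\{P_0,\ldots,P_s\}$ of a group $G$ (into non-empty parts) is unitary if $P_0=\{e\}$ and symmetric if $P_i=P_i^{-1}$ for all $i$. All metrics on groups are integral (integer valued) and right translation invariant: $d(gh,g'h)=d(g,g')$ for all $g,g',h\in G$. The weight of $d$ is $w(x)=d(x,e)$. The partition induced by $d$, denoted $P(G,d)$, is the set of classes of the equivalence relation $g\sim h\Leftrightarrow w(g)=w(h)$; $d$ is associated to a partition $\mathcal{P}$ if $P(G,d)=\mathcal{P}$. An interval metric is such an invariant integral metric $d$ with finitely many weights and without gaps: if $P(G,d)$ has $n$ parts different from $\{e\}$, then the set of values of $w$ is exactly $\{0,1,\ldots,n\}$. Notation: $P_i\ast P_i=\{gh: g,h\in P_i\}$. *)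

theory Defs
  imports "HOL-Algebra.Coset" "HOL-Analysis.Abstract_Metric_Spaces" "HOL-Library.Disjoint_Sets"
begin

definition unitary_symmetric_partition ::
    "('a, 'b) monoid_scheme \<Rightarrow> nat \<Rightarrow> (nat \<Rightarrow> 'a set) \<Rightarrow> bool" where
  "unitary_symmetric_partition G s P \<longleftrightarrow>
     partition_on (carrier G) (P ` {0..s}) \<and> inj_on P {0..s} \<and>
     P 0 = {\<one>\<^bsub>G\<^esub>} \<and> (\<forall>i\<in>{0..s}. set_inv\<^bsub>G\<^esub> (P i) = P i)"

text \<open>
  Integrality is expressed by the type of \<open>d\<close>.  The locale \<^locale>\<open>Metric_space\<close> also asks
  for symmetry and nonnegativity off the carrier; values there are irrelevant, and every metric
  on the carrier can be extended by \<open>0\<close>.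
\<close>

definition invariant_metric ::
    "('a, 'b) monoid_scheme \<Rightarrow> ('a \<Rightarrow> 'a \<Rightarrow> int) \<Rightarrow> bool" where
  "invariant_metric G d \<longleftrightarrow>
     Metric_space (carrier G) (\<lambda>x y. real_of_int (d x y)) \<and>
     (\<forall>g\<in>carrier G. \<forall>g'\<in>carrier G. \<forall>h\<in>carrier G.
        d (g \<otimes>\<^bsub>G\<^esub> h) (g' \<otimes>\<^bsub>G\<^esub> h) = d g g')"

definition weight ::
    "('a, 'b) monoid_scheme \<Rightarrow> ('a \<Rightarrow> 'a \<Rightarrow> int) \<Rightarrow> 'a \<Rightarrow> int" where
  "weight G d x = d x \<one>\<^bsub>G\<^esub>"

definition induced_partition ::
    "('a, 'b) monoid_scheme \<Rightarrow> ('a \<Rightarrow> 'a \<Rightarrow> int) \<Rightarrow> 'a set set" where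
  "induced_partition G d =
     carrier G // {(g, h). g \<in> carrier G \<and> h \<in> carrier G \<and> weight G d g = weight G d h}"

definition interval_metric ::
    "('a, 'b) monoid_scheme \<Rightarrow> ('a \<Rightarrow> 'a \<Rightarrow> int) \<Rightarrow> bool" where
  "interval_metric G d \<longleftrightarrow>
     invariant_metric G d \<and> finite (weight G d ` carrier G) \<and>
     weight G d ` carrier G = {0..int (card (induced_partition G d - {{\<one>\<^bsub>G\<^esub>}}))}"

end

theory Submission
  imports Defs
begin

text \<open>
  The product of the weight-one part with itself avoids that part and, by the triangle
  inequality, only contains weights at most 2.  Hence it meets at most one part besides
  \<open>P\<^sub>0\<close> (the part of weight 2), whereas at least two are required.
\<close>

text \<open>Right invariance, applied to the pair \<open>g\<close>, \<open>\<one>\<close> translated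
  by \<open>h\<close>, shows that the distance from \<open>g \<otimes> h\<close> to \<open>h\<close>
  is the weight of \<open>g\<close>; the triangle inequality through \<open>h\<close> then gives the
  bound.\<close>

lemma weight_mult_le:
  fixes G (structure)
  assumes "group G" "invariant_metric G d" "g \<in> carrier G" "h \<in> carrier G"
  shows "weight G d (g \<otimes> h) \<le> weight G d g + weight G d h"
proof -
  interpret group G by fact
  interpret Metric_space "carrier G" "\<lambda>x y. real_of_int (d x y)"
    using assms(2) by (simp add: invariant_metric_def)
  have "real_of_int (d (g \<otimes> h) \<one>) \<le> real_of_int (d (g \<otimes> h) h) + real_of_int (d h \<one>)"
    using assms by (intro triangle) auto
  moreover have "d (g \<otimes> h) h = d g \<one>"
    using assms by (metis invariant_metric_def l_one one_closed)
  ultimately show ?thesis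
    by (simp add: weight_def)
qed

lemma weight_eq_0_iff:
  assumes "group G" "invariant_metric G d" "x \<in> carrier G"
  shows "weight G d x = 0 \<longleftrightarrow> x = \<one>\<^bsub>G\<^esub>"
proof -
  interpret Metric_space "carrier G" "\<lambda>x y. real_of_int (d x y)"
    using assms(2) by (simp add: invariant_metric_def)
  show ?thesis
    using zero[OF assms(3) monoid.one_closed[OF group.is_monoid[OF assms(1)]]]
    by (simp add: weight_def)
qed

lemma weight_nonneg:
  assumes "invariant_metric G d"
  shows "0 \<le> weight G d x"
proof -
  interpret Metric_space "carrier G" "\<lambda>x y. real_of_int (d x y)"
    using assms by (simp add: invariant_metric_def)
  show ?thesis
    using nonneg[of x "\<one>\<^bsub>G\<^esub>"] by (simp add: weight_def)
qed

lemma same_part_imp_same_weight: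
  assumes "A \<in> induced_partition G d" "x \<in> A" "y \<in> A"
  shows "weight G d x = weight G d y"
  using assms unfolding induced_partition_def by (auto elim!: quotientE)

lemma same_weight_imp_same_part:
  assumes "A \<in> induced_partition G d" "x \<in> A" "y \<in> carrier G" "weight G d x = weight G d y"
  shows "y \<in> A"
  using assms unfolding induced_partition_def by (auto elim!: quotientE)

theorem proposition2p4:
  fixes G :: "('a, 'b) monoid_scheme" and P :: "nat \<Rightarrow> 'a set" and s :: nat
    and d :: "'a \<Rightarrow> 'a \<Rightarrow> int"
  assumes "group G" and "s \<ge> 1"
    and "unitary_symmetric_partition G s P"
    and "\<forall>i\<in>{1..s}. \<exists>(l::nat) (j::nat \<Rightarrow> nat).
           l \<ge> 2 \<and> inj_on j {1..l} \<and> j ` {1..l} \<subseteq> {1..s} - {i} \<and>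
           P i <#>\<^bsub>G\<^esub> P i \<subseteq> P 0 \<union> (\<Union>k\<in>{1..l}. P (j k)) \<and>
           (\<forall>k\<in>{1..l}. (P i <#>\<^bsub>G\<^esub> P i) \<inter> P (j k) \<noteq> {})"
    and "invariant_metric G d"
    and "induced_partition G d = P ` {0..s}"
  shows "\<not> interval_metric G d"
proof
  assume interval: "interval_metric G d"
  define w where "w = weight G d"
  have part: "partition_on (carrier G) (P ` {0..s})" and inj: "inj_on P {0..s}"
    and P0: "P 0 = {\<one>\<^bsub>G\<^esub>}"
    using assms(3) by (auto simp: unitary_symmetric_partition_def)
  have P_carrier: "x \<in> carrier G" if "x \<in> P i" "i \<le> s" for x i
    using partition_onD1[OF part] that by auto
  \<comment> \<open>Disjointness only identifies the sets \<open>P i\<close> and \<open>P k\<close>;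
    injectivity of \<open>P\<close> passes from the sets to their indices.\<close>
  have index_eq: "i = k" if "x \<in> P i" "x \<in> P k" "i \<le> s" "k \<le> s" for x i k
  proof -
    have "P i = P k"
      using disjointD[OF partition_onD2[OF part], of "P i" "P k"] that by auto
    then show ?thesis
      using inj that by (auto dest: inj_onD)
  qed
  \<comment> \<open>Each \<open>P i\<close> is a full level set of \<open>w\<close>, so
    \<open>y\<close> falls into \<open>P i\<close> as soon as it shares the weight of
    \<open>x\<close>. Thus a weight determines the index of its part.\<close>
  have index_eq_weight: "i = k"
    if "x \<in> P i" "y \<in> P k" "w x = w y" "i \<le> s" "k \<le> s" for x y i k
  proof -
    have "P i \<in> induced_partition G d" "y \<in> carrier G"
      using that assms(6) P_carrier[of y k] by auto
    then have "y \<in> P i"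
      using same_weight_imp_same_part[of "P i" G d x y] that by (simp add: w_def)
    then show ?thesis
      using index_eq that by blast
  qed

  \<comment> \<open>Since \<open>s \<ge> 1\<close>, there is a part other than \<open>P 0\<close>,
    so the gap-free range of weights extends at least up to 1. This yields an element of weight
    1.\<close>
  have "P 1 \<noteq> P 0"
    using inj assms(2) by (auto dest: inj_onD)
  then have "P 1 \<in> induced_partition G d - {{\<one>\<^bsub>G\<^esub>}}"
    using assms(2,6) P0 by auto
  then have "card (induced_partition G d - {{\<one>\<^bsub>G\<^esub>}}) > 0"
    using assms(6) by (subst card_gt_0_iff) auto
  then have "1 \<in> w ` carrier G"
    using interval by (simp add: interval_metric_def w_def)
  then obtain x where x: "x \<in> carrier G" "w x = 1"
    by auto
  then obtain i where i: "x \<in> P i" "i \<le> s"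
    unfolding partition_onD1[OF part] by auto
  have "i \<noteq> 0"
  proof
    assume "i = 0"
    then have "x = \<one>\<^bsub>G\<^esub>"
      using i(1) P0 by simp
    then show False
      using x weight_eq_0_iff[OF assms(1,5) x(1)] by (simp add: w_def)
  qed
  then have "i \<in> {1..s}"
    using i by auto
  from assms(4)[rule_format, OF this] obtain l :: nat and j where lj:
    "l \<ge> 2" "inj_on j {1..l}" "j ` {1..l} \<subseteq> {1..s} - {i}"
    "\<forall>k\<in>{1..l}. (P i <#>\<^bsub>G\<^esub> P i) \<inter> P (j k) \<noteq> {}"
    by blast
  have w1: "w g = 1" if "g \<in> P i" for g
    using same_part_imp_same_weight[of "P i" G d g x] that i x assms(6) by (simp add: w_def)
  have weight_2: "\<exists>y\<in>P (j k). w y = 2" if k: "k \<in> {1..l}" for k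
  proof -
    obtain y where y: "y \<in> P i <#>\<^bsub>G\<^esub> P i" "y \<in> P (j k)"
      using lj(4) k by blast
    have jk: "j k \<in> {1..s}" "j k \<noteq> i"
      using subsetD[OF lj(3) imageI[OF k]] by auto
    obtain g h where gh: "g \<in> P i" "h \<in> P i" "y = g \<otimes>\<^bsub>G\<^esub> h"
      using y(1) by (auto simp: set_mult_def)
    have "w y \<le> w g + w h"
      unfolding w_def gh(3) using gh i P_carrier assms(1,5) by (intro weight_mult_le) blast+
    then have "w y \<le> 2"
      using w1 gh by simp
    \<comment> \<open>Weight 1 would put \<open>y\<close> in the same part as \<open>x\<close>,
      forcing \<open>j k = i\<close>, but the indices \<open>j k\<close> avoid
      \<open>i\<close>.\<close>
    moreover have "w y \<noteq> 1"
      using index_eq_weight[of x i y "j k"] x(2) i y(2) jk by auto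
    \<comment> \<open>Weight 0 would make \<open>y\<close> the identity, which lies in
      \<open>P 0\<close>, whereas \<open>j k \<ge> 1\<close>.\<close>
    moreover have "w y \<noteq> 0"
    proof
      assume "w y = 0"
      then have "y \<in> P 0"
        using weight_eq_0_iff[OF assms(1,5), of y] P_carrier[of y "j k"] y(2) jk(1) P0
        by (simp add: w_def)
      then show False
        using index_eq[of y 0 "j k"] y(2) jk(1) by simp
    qed
    moreover have "0 \<le> w y"
      using weight_nonneg[OF assms(5)] by (simp add: w_def)
    ultimately have "w y = 2"
      by linarith
    then show ?thesis
      using y by blast
  qed
  \<comment> \<open>As \<open>l \<ge> 2\<close>, both 1 and 2 are admissible values of
    \<open>k\<close>. The two parts share the weight 2, so their indices agree, against the
    injectivity of \<open>j\<close>.\<close>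
  obtain y z where yz: "y \<in> P (j 1)" "w y = 2" "z \<in> P (j 2)" "w z = 2"
    using weight_2[of 1] weight_2[of 2] lj(1) by auto
  have "j 1 \<in> {1..s}" "j 2 \<in> {1..s}"
    using subsetD[OF lj(3) imageI[of 1]] subsetD[OF lj(3) imageI[of 2]] lj(1) by auto
  then have "j 1 = j 2"
    using index_eq_weight[of y "j 1" z "j 2"] yz by auto
  then show False
    using inj_onD[OF lj(2), of 1 2] lj(1) by auto
qed

end
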